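(* Let $\nu$ be a finite nonzero Borel measure supported on $[0,L]$ (for some finite $L$), with $0\in\operatorname{supp}\nu$. For $\eta>0$, let $\Pi_\eta$ be the probability measure $\Pi_\eta(du)\propto e^{-\eta u}\nu(du)$ and let $U$ have law $\Pi_\eta$. Suppose that $$A_2:=\sup_{\eta>0}\eta^2\operatorname{Var}_{\Pi_\eta}(U)<\infty.$$ Then $F_\nu(u):=\nu([0,u])$ satisfies $$F_\nu(2u)\leq 2e^{4A_2}F_\nu(u),\qquad u>0.$$ If $A_2=0$, the doubling constant can be taken to be one, i.e. $F_\nu(2u)\leq F_\nu(u)$ for all $u>0$. *)

theory Defs
  imports "HOL-Probability.Probability"
begin

definition msupport :: "'a::topological_space measure \<Rightarrow> 'a set" where
  "msupport \<nu> = {x. \<forall>S. open S \<longrightarrow> x \<in> S \<longrightarrow> emeasure \<nu> S > 0}"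

text \<open>The factor in front of \<open>exp (- (\<eta> * u))\<close> is the normalization hidden in the
  proportionality sign of \<open>\<Pi>\<^sub>\<eta>(du) \<propto> exp (- (\<eta> * u)) \<nu>(du)\<close>. It is meaningful only when the
  integral is finite and positive, as it is for a finite nonzero \<open>\<nu>\<close> carried by a compact set.\<close>

definition tilted :: "real measure \<Rightarrow> real \<Rightarrow> real measure" where
  "tilted \<nu> \<eta> = density \<nu> (\<lambda>u. ennreal (exp (- (\<eta> * u)) / (\<integral>v. exp (- (\<eta> * v)) \<partial>\<nu>)))"

text \<open>A random variable with law \<open>\<Pi>\<^sub>\<eta>\<close> is realized as the identity on the probability space
  \<open>tilted \<nu> \<eta>\<close>.\<close>

definition scaled_var :: "real measure \<Rightarrow> real \<Rightarrow> real" where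
  "scaled_var \<nu> \<eta> = \<eta>\<^sup>2 * prob_space.variance (tilted \<nu> \<eta>) (\<lambda>u. u)"

definition dist_fun :: "real measure \<Rightarrow> real \<Rightarrow> real" where
  "dist_fun \<nu> u = measure \<nu> {0..u}"

end

theory Submission
  imports Defs
begin

text \<open>Let \<open>m \<eta>\<close> be the mean of the tilted law. Since \<open>m' = - Var\<close>, the hypothesis
  makes \<open>m \<eta> - A\<^sub>2 / \<eta>\<close> nondecreasing. As \<open>0\<close> lies in the support, \<open>m \<eta>\<close> tends to
  \<open>0\<close> at infinity, so \<open>\<eta> m \<eta> \<le> A\<^sub>2\<close>. Markov's inequality for the tilted law at \<open>\<eta> = 2 A\<^sub>2 / u\<close>
  then puts at least half of its mass on \<open>[0, u]\<close>, and undoing the tilt on \<open>[0, 2 u]\<close> costs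
  a factor \<open>e\<^bsup>2 \<eta> u\<^esup> = e\<^bsup>4 A\<^sub>2\<^esup>\<close>. For \<open>A\<^sub>2 = 0\<close>
  every \<open>\<eta> > 0\<close> puts all the mass there, and \<open>\<eta> \<rightarrow> 0\<close> gives the constant one.\<close>

text \<open>Lagrange form of the second-order remainder. Its factor 1/2 is dropped, since only the
  quadratic order in \<open>x\<close> matters when \<open>moment\<close> is differentiated.\<close>

lemma exp_minus_one_minus_bound:
  fixes x :: real
  shows "\<bar>exp x - 1 - x\<bar> \<le> x\<^sup>2 * exp \<bar>x\<bar>"
proof -
  obtain t where t: "\<bar>t\<bar> \<le> \<bar>x\<bar>" "exp x = (\<Sum>m<2. x ^ m / fact m) + exp t / fact 2 * x ^ 2"
    using Maclaurin_exp_le[of x 2] by blast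
  have "exp x - 1 - x = exp t / 2 * x\<^sup>2"
    using t(2) by (simp add: numeral_2_eq_2)
  moreover have "exp t / 2 \<le> exp \<bar>x\<bar>"
    using t(1) by (intro order_trans[of "exp t / 2" "exp t" "exp \<bar>x\<bar>"]) auto
  ultimately show ?thesis
    using mult_left_mono[of "exp t / 2" "exp \<bar>x\<bar>" "x\<^sup>2"]
    by (simp only: abs_mult abs_divide abs_exp_cancel abs_numeral abs_power2
        zero_le_power2 mult.commute[of "exp t / 2"])
qed

section \<open>Unnormalized moments of the exponential tilt\<close>

locale compact_measure = finite_measure M for M :: "real measure" +
  fixes L :: real
  assumes sets_eq [measurable_cong]: "sets M = sets borel"
    and null_outside: "emeasure M (- {0..L}) = 0"
    and zero_in_support: "0 \<in> msupport M"
begin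

lemma AE_interval: "AE x in M. 0 \<le> x \<and> x \<le> L"
proof (rule AE_I)
  show "emeasure M (- {0..L}) = 0" by (rule null_outside)
  show "- {0..L} \<in> sets M" by (simp add: sets_eq)
qed auto

text \<open>Up to the sign (-1)^k, the \<open>k\<close>-th derivative of the Laplace transform of
  \<open>M\<close>. Left unnormalized so that the moments are closed under differentiation;
  \<open>moment 0\<close> is the normalizing constant of \<open>tilted\<close>.\<close>

definition moment :: "nat \<Rightarrow> real \<Rightarrow> real" where
  "moment k \<eta> = (\<integral>x. x ^ k * exp (- (\<eta> * x)) \<partial>M)"

definition tilted_mean :: "real \<Rightarrow> real" where
  "tilted_mean \<eta> = moment 1 \<eta> / moment 0 \<eta>"

lemma moment_integrand_bound:
  assumes "0 \<le> x" "x \<le> L"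
  shows "\<bar>x ^ k * exp (- (\<eta> * x))\<bar> \<le> L ^ k * exp (\<bar>\<eta>\<bar> * L)"
proof -
  have "- (\<eta> * x) \<le> \<bar>\<eta>\<bar> * x"
    using assms(1) abs_ge_minus_self[of "\<eta> * x"] by (simp add: abs_mult)
  also have "\<dots> \<le> \<bar>\<eta>\<bar> * L"
    using assms by (intro mult_left_mono) auto
  finally have "exp (- (\<eta> * x)) \<le> exp (\<bar>\<eta>\<bar> * L)" by simp
  then show ?thesis
    using assms by (auto simp: abs_mult intro!: mult_mono power_mono)
qed

lemma moment_integrable: "integrable M (\<lambda>x. x ^ k * exp (- (\<eta> * x)))"
proof (rule integrable_const_bound)
  show "AE x in M. norm (x ^ k * exp (- (\<eta> * x))) \<le> L ^ k * exp (\<bar>\<eta>\<bar> * L)"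
    using AE_interval by eventually_elim (use moment_integrand_bound in simp)
qed measurable

lemma exp_integrable: "integrable M (\<lambda>x. exp (- (\<eta> * x)))"
  using moment_integrable[of 0 \<eta>] by simp

lemma moment_nonneg: "0 \<le> moment k \<eta>"
  unfolding moment_def using AE_interval by (intro integral_nonneg_AE) auto

text \<open>The support hypothesis enters here: an open interval around 0 has positive mass, and its
  negative half is null.\<close>

lemma measure_near_zero_pos:
  assumes "0 < \<epsilon>"
  shows "0 < measure M {0..\<epsilon>}"
proof -
  have "0 < emeasure M {-\<epsilon><..<\<epsilon>}"
    using zero_in_support assms unfolding msupport_def by auto
  also have "\<dots> \<le> emeasure M {0..\<epsilon>}"
    using AE_interval
    by (intro emeasure_mono_AE) (auto simp: sets_eq elim: eventually_mono)
  finally show ?thesis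
    by (simp add: emeasure_eq_measure)
qed

text \<open>The weight \<open>exp (\<eta> * b) * exp (- (\<eta> * x))\<close> is at least 1 on
  \<open>{0..b}\<close>. This gives positivity of the normalizer, its slow decay for large
  \<open>\<eta>\<close>, and the cost of undoing the tilt.\<close>

lemma moment_0_lower:
  assumes "0 \<le> \<eta>"
  shows "measure M {0..b} \<le> exp (\<eta> * b) * moment 0 \<eta>"
proof -
  have "measure M {0..b} = (\<integral>x. indicator {0..b} x \<partial>M)"
    by (simp add: sets_eq sets_eq_imp_space_eq[OF sets_eq])
  also have "\<dots> \<le> (\<integral>x. exp (\<eta> * b) * exp (- (\<eta> * x)) \<partial>M)"
  proof (rule integral_mono)
    fix x
    show "indicator {0..b} x \<le> exp (\<eta> * b) * exp (- (\<eta> * x))"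
      using assms by (auto simp: indicator_def mult_exp_exp mult_left_mono)
  qed (auto simp: sets_eq exp_integrable emeasure_eq_measure intro!: integrable_real_indicator)
  finally show ?thesis
    by (simp add: moment_def)
qed

lemma moment_0_pos:
  assumes "0 \<le> \<eta>"
  shows "0 < moment 0 \<eta>"
  using moment_0_lower[OF assms, of 1] measure_near_zero_pos[of 1]
  by (smt (verit) exp_gt_zero mult_nonneg_nonpos)

text \<open>Differentiation under the integral: the Taylor remainder of the integrand integrates to
  at most \<open>h\<^sup>2 * C\<close>, so the difference quotient errs by at most
  \<open>\<bar>h\<bar> * C\<close>.\<close>

lemma moment_deriv: "(moment k has_real_derivative - moment (Suc k) \<eta>) (at \<eta>)"
proof -
  \<comment> \<open>For \<open>\<bar>h\<bar> < 1\<close> and \<open>x \<ge> 0\<close> the remainder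
    factor \<open>exp \<bar>h * x\<bar>\<close> is at most \<open>exp x\<close>, which shifts the
    tilt to \<open>\<eta> - 1\<close>; the factor \<open>x\<^sup>2\<close> raises the order by two.
    Thus \<open>C\<close> does not depend on \<open>h\<close>.\<close>
  define C where "C = moment (k + 2) (\<eta> - 1)"
  have bound: "\<bar>(moment k (\<eta> + h) - moment k \<eta>) / h - - moment (Suc k) \<eta>\<bar> \<le> \<bar>h\<bar> * C"
    if h: "h \<noteq> 0" "\<bar>h\<bar> < 1" for h
  proof -
    let ?r = "\<lambda>x. x ^ k * exp (- ((\<eta> + h) * x)) - x ^ k * exp (- (\<eta> * x))
      + h * (x ^ Suc k * exp (- (\<eta> * x)))"
    have int: "integrable M ?r"
      by (intro Bochner_Integration.integrable_add Bochner_Integration.integrable_diff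
        integrable_mult_right moment_integrable)
    have eq: "moment k (\<eta> + h) - moment k \<eta> + h * moment (Suc k) \<eta> = (\<integral>x. ?r x \<partial>M)"
      unfolding moment_def
      by (simp only: moment_integrable Bochner_Integration.integral_add
        Bochner_Integration.integral_diff Bochner_Integration.integrable_diff
        integrable_mult_right integral_mult_right_zero)
    have "\<bar>\<integral>x. ?r x \<partial>M\<bar> \<le> (\<integral>x. \<bar>?r x\<bar> \<partial>M)"
      by (rule integral_abs_bound)
    also have "\<dots> \<le> (\<integral>x. h\<^sup>2 * (x ^ (k + 2) * exp (- ((\<eta> - 1) * x))) \<partial>M)"
    proof (rule integral_mono_AE)
      show "integrable M (\<lambda>x. \<bar>?r x\<bar>)" using int by (rule integrable_abs)
      show "integrable M (\<lambda>x. h\<^sup>2 * (x ^ (k + 2) * exp (- ((\<eta> - 1) * x))))"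
        by (intro integrable_mult_right moment_integrable)
      show "AE x in M. \<bar>?r x\<bar> \<le> h\<^sup>2 * (x ^ (k + 2) * exp (- ((\<eta> - 1) * x)))"
        using AE_interval
      proof eventually_elim
        case (elim x)
        have "?r x = x ^ k * exp (- (\<eta> * x)) * (exp (- (h * x)) - 1 - (- (h * x)))"
          by (simp add: algebra_simps mult_exp_exp)
        then have "\<bar>?r x\<bar> = x ^ k * exp (- (\<eta> * x)) * \<bar>exp (- (h * x)) - 1 - (- (h * x))\<bar>"
          using elim by (simp add: abs_mult)
        also have "\<dots> \<le> x ^ k * exp (- (\<eta> * x)) * ((- (h * x))\<^sup>2 * exp \<bar>- (h * x)\<bar>)"
          using elim by (intro mult_left_mono exp_minus_one_minus_bound) auto
        also have "\<dots> \<le> x ^ k * exp (- (\<eta> * x)) * ((- (h * x))\<^sup>2 * exp x)"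
          using elim h by (intro mult_left_mono) (auto simp: abs_mult mult_left_le_one_le)
        also have "\<dots> = h\<^sup>2 * (x ^ (k + 2) * exp (- ((\<eta> - 1) * x)))"
          by (simp add: algebra_simps power2_eq_square mult_exp_exp)
        finally show ?case .
      qed
    qed
    also have "\<dots> = h\<^sup>2 * C"
      by (simp add: C_def moment_def)
    finally have "\<bar>moment k (\<eta> + h) - moment k \<eta> + h * moment (Suc k) \<eta>\<bar> \<le> h\<^sup>2 * C"
      using eq by simp
    then have "\<bar>moment k (\<eta> + h) - moment k \<eta> + h * moment (Suc k) \<eta>\<bar> / \<bar>h\<bar> \<le> h\<^sup>2 * C / \<bar>h\<bar>"
      by (intro divide_right_mono) auto
    moreover have "h\<^sup>2 * C / \<bar>h\<bar> = \<bar>h\<bar> * C"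
      using h by (simp add: field_simps power2_eq_square flip: abs_mult)
    moreover have "(moment k (\<eta> + h) - moment k \<eta>) / h - - moment (Suc k) \<eta>
        = (moment k (\<eta> + h) - moment k \<eta> + h * moment (Suc k) \<eta>) / h"
      using h by (simp add: field_simps)
    ultimately show ?thesis by (simp add: abs_divide)
  qed
  have "((\<lambda>h. (moment k (\<eta> + h) - moment k \<eta>) / h - - moment (Suc k) \<eta>) \<longlongrightarrow> 0) (at 0)"
  proof (rule Lim_null_comparison)
    show "\<forall>\<^sub>F h in at 0. norm ((moment k (\<eta> + h) - moment k \<eta>) / h - - moment (Suc k) \<eta>)
        \<le> \<bar>h\<bar> * C"
      unfolding eventually_at using bound by (intro exI[of _ 1]) (auto simp: dist_real_def)
    show "((\<lambda>h. \<bar>h\<bar> * C) \<longlongrightarrow> 0) (at (0::real))"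
      by (auto intro!: tendsto_eq_intros)
  qed
  then show ?thesis
    unfolding DERIV_def by (rule LIM_zero_cancel)
qed

section \<open>Mean and variance of the tilted law\<close>

lemma expectation_tilted:
  assumes "0 \<le> \<eta>" and [measurable]: "f \<in> borel_measurable borel"
  shows "(\<integral>x. f x \<partial>tilted M \<eta>) = (\<integral>x. f x * exp (- (\<eta> * x)) \<partial>M) / moment 0 \<eta>"
proof -
  have "(\<integral>x. f x \<partial>tilted M \<eta>) = (\<integral>x. exp (- (\<eta> * x)) / moment 0 \<eta> * f x \<partial>M)"
    unfolding tilted_def using moment_0_pos[OF assms(1)]
    by (subst integral_real_density) (auto simp: moment_def)
  then show ?thesis
    by (simp add: mult.commute)
qed

lemma scaled_var_eq:
  assumes "0 \<le> \<eta>"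
  shows "scaled_var M \<eta> = \<eta>\<^sup>2 * (moment 2 \<eta> / moment 0 \<eta> - (tilted_mean \<eta>)\<^sup>2)"
proof -
  let ?m = "tilted_mean \<eta>"
  note pos = moment_0_pos[OF assms]
  have mean: "(\<integral>x. x \<partial>tilted M \<eta>) = ?m"
    using expectation_tilted[OF assms, of "\<lambda>x. x"] by (simp add: tilted_mean_def moment_def)
  have "(\<integral>x. (x - ?m)\<^sup>2 * exp (- (\<eta> * x)) \<partial>M)
    = (\<integral>x. x ^ 2 * exp (- (\<eta> * x)) - 2 * ?m * (x ^ 1 * exp (- (\<eta> * x)))
        + ?m\<^sup>2 * (x ^ 0 * exp (- (\<eta> * x))) \<partial>M)"
    by (intro Bochner_Integration.integral_cong) (auto simp: power2_eq_square algebra_simps)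
  also have "\<dots> = moment 2 \<eta> - 2 * ?m * moment 1 \<eta> + ?m\<^sup>2 * moment 0 \<eta>"
    unfolding moment_def
    by (simp only: moment_integrable Bochner_Integration.integral_add
        Bochner_Integration.integral_diff Bochner_Integration.integrable_diff
        integrable_mult_right integral_mult_right_zero)
  finally have "(\<integral>x. (x - ?m)\<^sup>2 \<partial>tilted M \<eta>)
      = (moment 2 \<eta> - 2 * ?m * moment 1 \<eta> + ?m\<^sup>2 * moment 0 \<eta>) / moment 0 \<eta>"
    by (subst expectation_tilted[OF assms]) auto
  also have "\<dots> = moment 2 \<eta> / moment 0 \<eta> - ?m\<^sup>2"
    using pos by (simp add: tilted_mean_def field_simps power2_eq_square)
  finally show ?thesis
    unfolding scaled_var_def mean by simp
qed

lemma scaled_var_nonneg: "0 \<le> scaled_var M \<eta>"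
  unfolding scaled_var_def by simp

text \<open>By the quotient rule the derivative is minus the second normalized moment plus the
  squared mean, that is, minus the variance; dividing by \<open>\<eta>\<^sup>2\<close> removes the
  scaling.\<close>

lemma tilted_mean_deriv:
  assumes "0 < \<eta>"
  shows "(tilted_mean has_real_derivative - (scaled_var M \<eta> / \<eta>\<^sup>2)) (at \<eta>)"
proof -
  have nz: "moment 0 \<eta> \<noteq> 0"
    using moment_0_pos[of \<eta>] assms by simp
  have "((\<lambda>\<eta>. moment 1 \<eta> / moment 0 \<eta>) has_real_derivative
      (- moment (Suc 1) \<eta> * moment 0 \<eta> - moment 1 \<eta> * (- moment (Suc 0) \<eta>))
        / (moment 0 \<eta> * moment 0 \<eta>)) (at \<eta>)"
    by (intro DERIV_divide moment_deriv nz)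
  moreover have "(- moment (Suc 1) \<eta> * moment 0 \<eta> - moment 1 \<eta> * (- moment (Suc 0) \<eta>))
        / (moment 0 \<eta> * moment 0 \<eta>) = - (scaled_var M \<eta> / \<eta>\<^sup>2)"
    using assms nz
    by (simp add: scaled_var_eq tilted_mean_def field_simps power2_eq_square numeral_2_eq_2)
  ultimately show ?thesis
    unfolding tilted_mean_def[abs_def] by simp
qed

text \<open>Points up to \<open>\<epsilon>\<close> contribute at most \<open>\<epsilon>\<close> to
  the mean. Points beyond carry weight at most \<open>exp (- (\<eta> * \<epsilon>))\<close>, while
  the mass near 0 keeps the normalizer above a multiple of
  \<open>exp (- (\<eta> * (\<epsilon> / 2)))\<close>.\<close>

lemma tilted_mean_eventually_less:
  assumes "0 < d"
  shows "\<forall>\<^sub>F \<eta> in at_top. tilted_mean \<eta> < d"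
proof -
  \<comment> \<open>The bound on the mean tends to \<open>\<epsilon>\<close>, so taking half of
    \<open>d\<close> makes the final inequality strict.\<close>
  define \<epsilon> where "\<epsilon> = d / 2"
  \<comment> \<open>The shorter interval, of length \<open>\<epsilon> / 2\<close>, leaves a net
    decay of \<open>exp (- (\<eta> * (\<epsilon> / 2)))\<close> after division by the
    normalizer.\<close>
  define c where "c = measure M {0..\<epsilon> / 2}"
  define K where "K = \<bar>L\<bar> * measure M (space M) / c"
  have \<epsilon>: "0 < \<epsilon>" using assms by (simp add: \<epsilon>_def)
  then have c: "0 < c" unfolding c_def by (intro measure_near_zero_pos) simp
  have bound: "tilted_mean \<eta> \<le> \<epsilon> + K * exp (- (\<eta> * (\<epsilon> / 2)))" if \<eta>: "0 \<le> \<eta>" for \<eta>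
  proof -
    have "moment 1 \<eta> \<le> (\<integral>x. \<epsilon> * exp (- (\<eta> * x)) + \<bar>L\<bar> * exp (- (\<eta> * \<epsilon>)) \<partial>M)"
      unfolding moment_def
    proof (rule integral_mono_AE)
      show "AE x in M. x ^ 1 * exp (- (\<eta> * x)) \<le> \<epsilon> * exp (- (\<eta> * x)) + \<bar>L\<bar> * exp (- (\<eta> * \<epsilon>))"
        using AE_interval
      proof eventually_elim
        case (elim x)
        show ?case
        proof (cases "x \<le> \<epsilon>")
          case True
          then have "x * exp (- (\<eta> * x)) \<le> \<epsilon> * exp (- (\<eta> * x))" by simp
          then show ?thesis by (simp add: add_increasing2)
        next
          case False
          then have "x * exp (- (\<eta> * x)) \<le> \<bar>L\<bar> * exp (- (\<eta> * \<epsilon>))"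
            using elim \<eta> by (intro mult_mono) (auto intro: mult_left_mono)
          then show ?thesis using \<epsilon> by (simp add: add_increasing)
        qed
      qed
    qed (intro moment_integrable Bochner_Integration.integrable_add integrable_mult_right
        exp_integrable integrable_const)+
    also have "\<dots> = \<epsilon> * moment 0 \<eta> + \<bar>L\<bar> * measure M (space M) * exp (- (\<eta> * \<epsilon>))"
      by (simp add: moment_def exp_integrable)
    finally have "moment 1 \<eta> \<le> \<epsilon> * moment 0 \<eta> + \<bar>L\<bar> * measure M (space M) * exp (- (\<eta> * \<epsilon>))" .
    moreover have "\<bar>L\<bar> * measure M (space M) * exp (- (\<eta> * \<epsilon>))
        \<le> K * exp (- (\<eta> * (\<epsilon> / 2))) * moment 0 \<eta>"
    proof -
      have "\<bar>L\<bar> * measure M (space M) * exp (- (\<eta> * \<epsilon>)) = K * exp (- (\<eta> * \<epsilon>)) * c"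
        using c by (simp add: K_def)
      also have "\<dots> \<le> K * exp (- (\<eta> * \<epsilon>)) * (exp (\<eta> * (\<epsilon> / 2)) * moment 0 \<eta>)"
        unfolding c_def using moment_0_lower[OF \<eta>, of "\<epsilon> / 2"] c
        by (intro mult_left_mono) (auto simp: K_def)
      also have "\<dots> = K * (exp (- (\<eta> * \<epsilon>)) * exp (\<eta> * (\<epsilon> / 2))) * moment 0 \<eta>"
        by simp
      also have "exp (- (\<eta> * \<epsilon>)) * exp (\<eta> * (\<epsilon> / 2)) = exp (- (\<eta> * (\<epsilon> / 2)))"
        by (simp add: mult_exp_exp)
      finally show ?thesis .
    qed
    ultimately have "moment 1 \<eta> \<le> (\<epsilon> + K * exp (- (\<eta> * (\<epsilon> / 2)))) * moment 0 \<eta>"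
      by (simp add: algebra_simps)
    then show ?thesis
      unfolding tilted_mean_def using moment_0_pos[OF \<eta>] by (simp add: divide_le_eq)
  qed
  have "((\<lambda>\<eta>. \<epsilon> + K * exp (- (\<eta> * (\<epsilon> / 2)))) \<longlongrightarrow> \<epsilon> + K * 0) at_top"
  proof (intro tendsto_intros filterlim_compose[OF exp_at_bot])
    show "filterlim (\<lambda>\<eta>. - (\<eta> * (\<epsilon> / 2))) at_bot at_top"
      unfolding filterlim_uminus_at_bot minus_minus using \<epsilon>
      by (intro filterlim_at_top_mult_tendsto_pos[OF tendsto_const _ filterlim_ident]) simp
  qed
  then have "\<forall>\<^sub>F \<eta> in at_top. \<epsilon> + K * exp (- (\<eta> * (\<epsilon> / 2))) < d"
    using assms by (intro order_tendstoD(2)[where y = "\<epsilon> + K * 0"]) (simp_all add: \<epsilon>_def)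
  then show ?thesis
    using eventually_ge_at_top[of 0]
    by eventually_elim (use bound in fastforce)
qed

text \<open>The excess of the mean over \<open>A / \<eta>\<close> is nondecreasing in
  \<open>\<eta>\<close>, so a positive excess would persist and keep the mean away from 0.\<close>

lemma tilted_mean_le:
  assumes A: "\<And>\<eta>. 0 < \<eta> \<Longrightarrow> scaled_var M \<eta> \<le> A" and "0 < \<eta>"
  shows "tilted_mean \<eta> \<le> A / \<eta>"
proof (rule ccontr)
  assume "\<not> ?thesis"
  then have d: "0 < tilted_mean \<eta> - A / \<eta>" by simp
  have "0 \<le> A"
    using A[of 1] scaled_var_nonneg[of 1] by simp
  have mono: "tilted_mean \<eta> - A / \<eta> \<le> tilted_mean s - A / s" if "\<eta> \<le> s" for s
  proof (rule DERIV_nonneg_imp_nondecreasing[OF that])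
    fix t assume "\<eta> \<le> t" "t \<le> s"
    then have t: "0 < t" using assms(2) by simp
    have "((\<lambda>t. tilted_mean t - A / t) has_real_derivative
        - (scaled_var M t / t\<^sup>2) + A / t\<^sup>2) (at t)"
      using t by (auto intro!: derivative_eq_intros tilted_mean_deriv simp: power2_eq_square)
    moreover have "0 \<le> - (scaled_var M t / t\<^sup>2) + A / t\<^sup>2"
      using A[OF t] by (simp add: divide_right_mono)
    ultimately show "\<exists>y. ((\<lambda>t. tilted_mean t - A / t) has_real_derivative y) (at t) \<and> 0 \<le> y"
      by blast
  qed
  \<comment> \<open>The assumed excess at \<open>\<eta>\<close> itself serves as the threshold below
    which the mean must fall.\<close>
  have "\<forall>\<^sub>F s in at_top. tilted_mean s < tilted_mean \<eta> - A / \<eta> \<and> \<eta> \<le> s"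
    by (intro eventually_conj tilted_mean_eventually_less d eventually_ge_at_top)
  then obtain s where s: "tilted_mean s < tilted_mean \<eta> - A / \<eta>" "\<eta> \<le> s"
    using eventually_happens by force
  have "0 \<le> A / s" using \<open>0 \<le> A\<close> s(2) assms(2) by simp
  then show False using mono[OF s(2)] s(1) by simp
qed

section \<open>Markov's inequality and doubling\<close>

text \<open>Markov's inequality multiplied by the normalizer: beyond \<open>u\<close> the factor
  \<open>x / u\<close> exceeds 1, and on \<open>{0..u}\<close> the tilt is at most 1, so the
  untilted mass bounds that part.\<close>

lemma moment_0_markov:
  assumes "0 < u" "0 \<le> \<eta>"
  shows "moment 0 \<eta> * (1 - tilted_mean \<eta> / u) \<le> measure M {0..u}"
proof -
  have int: "integrable M (indicat_real {0..u})"
    by (intro integrable_real_indicator) (auto simp: sets_eq emeasure_eq_measure)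
  have "moment 0 \<eta> \<le> (\<integral>x. indicator {0..u} x + 1 / u * (x ^ 1 * exp (- (\<eta> * x))) \<partial>M)"
    unfolding moment_def
  proof (rule integral_mono_AE)
    show "AE x in M. x ^ 0 * exp (- (\<eta> * x))
        \<le> indicator {0..u} x + 1 / u * (x ^ 1 * exp (- (\<eta> * x)))"
      using AE_interval
    proof eventually_elim
      case (elim x)
      show ?case
      proof (cases "x \<le> u")
        case True
        then show ?thesis using elim assms by (simp add: add_increasing2)
      next
        case False
        then show ?thesis using assms by (simp add: indicator_def field_simps)
      qed
    qed
  qed (intro int moment_integrable Bochner_Integration.integrable_add integrable_mult_right)+
  also have "\<dots> = measure M {0..u} + moment 1 \<eta> / u"
    unfolding moment_def
    by (simp add: int moment_integrable[of 1, simplified] sets_eq_imp_space_eq[OF sets_eq])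
  finally show ?thesis
    using moment_0_pos[OF assms(2)] by (simp add: tilted_mean_def field_simps)
qed

text \<open>The tilt \<open>\<eta>\<close> stays free because the two claims of the theorem choose
  it differently. The condition \<open>A \<le> \<eta> * u\<close> makes the factor on the left
  nonnegative, so the tilt can be undone on \<open>{0..2 * u}\<close> under it.\<close>

lemma dist_fun_double_le:
  assumes A: "\<And>\<eta>. 0 < \<eta> \<Longrightarrow> scaled_var M \<eta> \<le> A" and u: "0 < u" and \<eta>: "0 < \<eta>" "A \<le> \<eta> * u"
  shows "dist_fun M (2 * u) * (1 - A / (\<eta> * u)) \<le> exp (2 * \<eta> * u) * dist_fun M u"
proof -
  have "A / (\<eta> * u) \<le> 1" using \<eta> u by simp
  then have "dist_fun M (2 * u) * (1 - A / (\<eta> * u))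
      \<le> exp (\<eta> * (2 * u)) * moment 0 \<eta> * (1 - A / (\<eta> * u))"
    unfolding dist_fun_def using \<eta> by (intro mult_right_mono moment_0_lower) auto
  also have "\<dots> \<le> exp (\<eta> * (2 * u)) * moment 0 \<eta> * (1 - tilted_mean \<eta> / u)"
    using divide_right_mono[OF tilted_mean_le[OF A \<eta>(1)], of u] u
    by (intro mult_left_mono) (auto simp: moment_nonneg)
  also have "\<dots> \<le> exp (\<eta> * (2 * u)) * measure M {0..u}"
    using moment_0_markov[of u \<eta>] u \<eta> by (simp add: mult.assoc)
  finally show ?thesis by (simp add: dist_fun_def algebra_simps)
qed

end

theorem lemma3p3:
  fixes \<nu> :: "real measure" and L A\<^sub>2 :: real
  assumes "sets \<nu> = sets borel"
    and "finite_measure \<nu>"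
    and "emeasure \<nu> (space \<nu>) \<noteq> 0"
    and "emeasure \<nu> (- {0..L}) = 0"
    and "0 \<in> msupport \<nu>"
    and "bdd_above (scaled_var \<nu> ` {0<..})"
    and "A\<^sub>2 = (SUP \<eta>\<in>{0<..}. scaled_var \<nu> \<eta>)"
  shows "(\<forall>u>0. dist_fun \<nu> (2 * u) \<le> 2 * exp (4 * A\<^sub>2) * dist_fun \<nu> u) \<and>
    (A\<^sub>2 = 0 \<longrightarrow> (\<forall>u>0. dist_fun \<nu> (2 * u) \<le> dist_fun \<nu> u))"
proof -
  interpret finite_measure \<nu> by fact
  interpret compact_measure \<nu> L by unfold_locales fact+
  have A: "scaled_var \<nu> \<eta> \<le> A\<^sub>2" if "0 < \<eta>" for \<eta>
    \<comment> \<open>Boundedness is what makes the real-valued supremum an actual upper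
      bound.\<close>
    using assms(6,7) that by (auto intro!: cSUP_upper)
  then have "0 \<le> A\<^sub>2"
    using scaled_var_nonneg[of 1] order_trans zero_less_one by blast
  have zero: "dist_fun \<nu> (2 * u) \<le> dist_fun \<nu> u" if A0: "A\<^sub>2 = 0" and u: "0 < u" for u
  proof (rule tendsto_le)
    show "((\<lambda>\<eta>. exp (2 * \<eta> * u) * dist_fun \<nu> u) \<longlongrightarrow> dist_fun \<nu> u) (at_right 0)"
      by (auto intro!: tendsto_eq_intros)
    show "\<forall>\<^sub>F \<eta> in at_right 0. dist_fun \<nu> (2 * u) \<le> exp (2 * \<eta> * u) * dist_fun \<nu> u"
      using eventually_at_right_less[of 0]
      \<comment> \<open>With \<open>A\<^sub>2 = 0\<close> the side condition holds for every
        positive \<open>\<eta>\<close> and the factor on the left equals 1.\<close>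
      by eventually_elim (use dist_fun_double_le[OF A u] A0 u in auto)
  qed auto
  have "dist_fun \<nu> (2 * u) \<le> 2 * exp (4 * A\<^sub>2) * dist_fun \<nu> u" if u: "0 < u" for u
  \<comment> \<open>The choice \<open>\<eta> = 2 * A\<^sub>2 / u\<close> is positive only for
    nonzero \<open>A\<^sub>2\<close>. It makes the factor on the left 1/2 and the exponent
    \<open>4 * A\<^sub>2\<close>.\<close>
  proof (cases "A\<^sub>2 = 0")
    case True
    have "0 \<le> dist_fun \<nu> u" by (simp add: dist_fun_def)
    then show ?thesis using zero[OF True u] True by simp
  next
    case False
    then show ?thesis
      using dist_fun_double_le[OF A u, of "2 * A\<^sub>2 / u"] u \<open>0 \<le> A\<^sub>2\<close> by simp
  qed
  with zero show ?thesis by blast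
qed

end
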